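(* The positive integers that are expressible as a sum of successive odd positive numbers and are not expressible as a sum of successive even positive numbers are exactly the composite odd positive integers together with the even numbers of the form $2^{n+1}$, where $n$ is a positive integer.
   Context: A sum of successive odd (respectively even) positive numbers is a sum $a+(a+2)+(a+4)+\cdots+(a+2(r-1))$ with $r\ge 2$ terms, where $a$ is an odd (respectively even) positive integer. *)

theory Defs
  imports "HOL-Computational_Algebra.Primes"
begin

definition sum_successive_odd :: "nat \<Rightarrow> bool" where
  "sum_successive_odd N \<longleftrightarrow>
     (\<exists>a r. odd a \<and> 0 < a \<and> 2 \<le> r \<and> N = (\<Sum>i<r. a + 2 * i))"

definition sum_successive_even :: "nat \<Rightarrow> bool" where
  "sum_successive_even N \<longleftrightarrow>
     (\<exists>a r. even a \<and> 0 < a \<and> 2 \<le> r \<and> N = (\<Sum>i<r. a + 2 * i))"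

definition composite :: "nat \<Rightarrow> bool" where
  "composite N \<longleftrightarrow> 1 < N \<and> \<not> prime N"

end

theory Submission
  imports Defs
begin

text \<open>
  An arithmetic progression with difference 2, first term \<open>a\<close> and \<open>r\<close> terms has the sum
  \<open>r * b\<close>, where \<open>b = a + r - 1\<close> is the mean of the terms. Conversely, in a factorization
  \<open>N = r * b\<close> with \<open>2 \<le> r \<le> b\<close> the first term is recovered as \<open>a = b - r + 1\<close>: it is
  positive, and it is odd exactly when \<open>r\<close> and \<open>b\<close> have the same parity. Thus sums of successive
  odd (even) numbers are the products of two factors greater than 1 of equal (opposite) parity;
  the order of the factors is irrelevant, since the smaller one may serve as the number of terms.

  Factors of equal parity are both odd or both even, so the odd case gives the odd composite
  numbers and the multiples of 4. Factors of opposite parity exist exactly for the even numbers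
  that have an odd divisor greater than 1, that is, the even numbers that are not powers of 2.
  Removing these from the odd composites and the multiples of 4 leaves the odd composites and the
  powers of 2 from 4 on.
\<close>

lemma sum_successive_eq_mult:
  fixes a r :: nat
  assumes "0 < a"
  shows "(\<Sum>i<r. a + 2 * i) = r * (a + r - 1)"
proof (induction r)
  case (Suc r)
  obtain c where "a = Suc c"
    using assms gr0_implies_Suc by blast
  with Suc show ?case
    by (simp add: algebra_simps)
qed simp

text \<open>Counting the terms by the smaller factor keeps the first term \<open>b - r + 1\<close> positive.\<close>

lemma mult_eq_sum_successive:
  fixes r b :: nat
  assumes "r \<le> b"
  shows "r * b = (\<Sum>i<r. (b - r + 1) + 2 * i)"
  by (subst sum_successive_eq_mult) (use assms in auto)

lemma sum_successive_odd_iff_factors: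
  "sum_successive_odd N \<longleftrightarrow>
     (\<exists>x y. 2 \<le> x \<and> 2 \<le> y \<and> (even x \<longleftrightarrow> even y) \<and> N = x * y)"
proof
  assume "sum_successive_odd N"
  then obtain a r where ar: "odd a" "0 < a" "2 \<le> r" "N = (\<Sum>i<r. a + 2 * i)"
    unfolding sum_successive_odd_def by blast
  have "N = r * (a + r - 1)"
    using ar sum_successive_eq_mult by simp
  moreover have "2 \<le> a + r - 1" "even r \<longleftrightarrow> even (a + r - 1)"
    using ar by auto
  ultimately show "\<exists>x y. 2 \<le> x \<and> 2 \<le> y \<and> (even x \<longleftrightarrow> even y) \<and> N = x * y"
    using ar(3) by blast
next
  have ordered: "sum_successive_odd (r * b)"
    if "2 \<le> r" "r \<le> b" "even r \<longleftrightarrow> even b" for r b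
  proof -
    have "odd (b - r + 1)"
      using that by auto
    then show ?thesis
      unfolding sum_successive_odd_def mult_eq_sum_successive[OF that(2)]
      using that(1) by (intro exI[of _ "b - r + 1"] exI[of _ r] conjI refl) simp_all
  qed
  assume "\<exists>x y. 2 \<le> x \<and> 2 \<le> y \<and> (even x \<longleftrightarrow> even y) \<and> N = x * y"
  then obtain x y where "2 \<le> x" "2 \<le> y" "even x \<longleftrightarrow> even y" "N = x * y"
    by blast
  then show "sum_successive_odd N"
    using ordered by (metis mult.commute nat_le_linear)
qed

lemma sum_successive_even_iff_factors:
  "sum_successive_even N \<longleftrightarrow> (\<exists>x y. 2 \<le> x \<and> 2 \<le> y \<and> even x \<and> odd y \<and> N = x * y)"
proof
  assume "sum_successive_even N"
  then obtain a r where ar: "even a" "0 < a" "2 \<le> r" "N = (\<Sum>i<r. a + 2 * i)"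
    unfolding sum_successive_even_def by blast
  have "N = r * (a + r - 1)"
    using ar sum_successive_eq_mult by simp
  moreover have "2 \<le> a + r - 1" "even r \<longleftrightarrow> odd (a + r - 1)"
    using ar by auto
  ultimately show "\<exists>x y. 2 \<le> x \<and> 2 \<le> y \<and> even x \<and> odd y \<and> N = x * y"
    using ar(3) by (metis mult.commute)
next
  have ordered: "sum_successive_even (r * b)"
    if "2 \<le> r" "r \<le> b" "even r \<longleftrightarrow> odd b" for r b
  proof -
    have "even (b - r + 1)"
      using that by auto
    then show ?thesis
      unfolding sum_successive_even_def mult_eq_sum_successive[OF that(2)]
      using that(1) by (intro exI[of _ "b - r + 1"] exI[of _ r] conjI refl) simp_all
  qed
  assume "\<exists>x y. 2 \<le> x \<and> 2 \<le> y \<and> even x \<and> odd y \<and> N = x * y"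
  then obtain x y where "2 \<le> x" "2 \<le> y" "even x" "odd y" "N = x * y"
    by blast
  then show "sum_successive_even N"
    using ordered by (metis mult.commute nat_le_linear)
qed

lemma composite_iff_factors:
  "composite N \<longleftrightarrow> (\<exists>x y. 2 \<le> x \<and> 2 \<le> y \<and> N = x * y)"
proof
  assume "composite N"
  then have N: "1 < N" "\<not> prime N"
    unfolding composite_def by auto
  then obtain x where x: "x dvd N" "x \<noteq> 1" "x \<noteq> N"
    by (auto simp: prime_nat_iff)
  then obtain y where y: "N = x * y"
    by (auto elim: dvdE)
  have "x \<noteq> 0" "y \<noteq> 0" "y \<noteq> 1"
    using N x y by auto
  with x y show "\<exists>x y. 2 \<le> x \<and> 2 \<le> y \<and> N = x * y"
    by (intro exI[of _ x] exI[of _ y]) auto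
next
  assume "\<exists>x y. 2 \<le> x \<and> 2 \<le> y \<and> N = x * y"
  then obtain x y where xy: "2 \<le> x" "2 \<le> y" "N = x * y"
    by blast
  then have "1 < N"
    using less_1_mult[of x y] by simp
  moreover have "\<not> prime N"
    using xy prime_product[of x y] by auto
  ultimately show "composite N"
    unfolding composite_def by simp
qed

lemma sum_successive_odd_iff:
  assumes "0 < N"
  shows "sum_successive_odd N \<longleftrightarrow> odd N \<and> composite N \<or> 4 dvd N"
proof
  assume "sum_successive_odd N"
  then obtain x y where xy: "2 \<le> x" "2 \<le> y" "even x \<longleftrightarrow> even y" "N = x * y"
    unfolding sum_successive_odd_iff_factors by blast
  show "odd N \<and> composite N \<or> 4 dvd N"
  proof (cases "even x")
    case True
    then have "2 * 2 dvd x * y"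
      using xy by (intro mult_dvd_mono) auto
    then show ?thesis
      using xy(4) by simp
  next
    case False
    then show ?thesis
      using xy composite_iff_factors by auto
  qed
next
  assume "odd N \<and> composite N \<or> 4 dvd N"
  then show "sum_successive_odd N"
  proof
    assume "odd N \<and> composite N"
    then show ?thesis
      unfolding composite_iff_factors sum_successive_odd_iff_factors by auto
  next
    assume "4 dvd N"
    then obtain k where "N = 2 * (2 * k)"
      by (auto elim: dvdE)
    moreover from this assms have "2 \<le> 2 * k"
      by simp
    ultimately show ?thesis
      unfolding sum_successive_odd_iff_factors
      by (intro exI[of _ 2] exI[of _ "2 * k"]) auto
  qed
qed

text \<open>
  The odd part of \<open>N\<close>, paired with the full power of 2 in \<open>N\<close>, is a factorization of opposite
  parity unless one of the two is 1; conversely all divisors of a power of 2 except 1 are even.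
\<close>

lemma sum_successive_even_iff:
  assumes "0 < N"
  shows "sum_successive_even N \<longleftrightarrow> even N \<and> (\<nexists>k. N = 2 ^ k)"
proof
  assume "sum_successive_even N"
  then obtain x y where xy: "2 \<le> y" "even x" "odd y" "N = x * y"
    unfolding sum_successive_even_iff_factors by blast
  have "N \<noteq> 2 ^ k" for k
  proof
    assume "N = 2 ^ k"
    then have "y dvd 2 ^ k"
      using xy(4) by (metis dvd_triv_right)
    moreover have "coprime y (2 ^ k)"
      using xy(3) by simp
    ultimately have "y = 1"
      by (metis coprime_absorb_left nat_dvd_1_iff_1)
    then show False
      using xy(1) by simp
  qed
  moreover have "even N"
    using xy(2,4) by simp
  ultimately show "even N \<and> (\<nexists>k. N = 2 ^ k)"
    by blast
next
  assume N: "even N \<and> (\<nexists>k. N = 2 ^ k)"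
  obtain m where m: "N = 2 ^ multiplicity 2 N * m" "odd m"
    by (rule multiplicity_decompose'[of N 2]) (use assms in simp_all)
  define k where "k = multiplicity 2 N"
  have Nk: "N = 2 ^ k * m"
    using m(1) unfolding k_def .
  have "m \<noteq> 1"
  proof
    assume "m = 1"
    with Nk have "N = 2 ^ k"
      by simp
    with N show False
      by blast
  qed
  moreover have "0 < m"
    using m(2) by (rule odd_pos)
  ultimately have "2 \<le> m"
    by linarith
  have "k \<noteq> 0"
  proof
    assume "k = 0"
    with Nk have "N = m"
      by simp
    with N m(2) show False
      by blast
  qed
  then have even_pow: "even (2 ^ k :: nat)"
    by simp
  then have "2 \<le> (2 ^ k :: nat)"
    by (rule dvd_imp_le) simp
  with \<open>2 \<le> m\<close> even_pow m(2) Nk show "sum_successive_even N"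
    unfolding sum_successive_even_iff_factors
    by (intro exI[of _ "2 ^ k"] exI[of _ m] conjI)
qed

theorem mainTheorem3:
  shows "{N::nat. 0 < N \<and> sum_successive_odd N \<and> \<not> sum_successive_even N} =
         {N::nat. 0 < N \<and> odd N \<and> composite N} \<union>
         {N::nat. even N \<and> (\<exists>n::nat. 0 < n \<and> N = 2 ^ (n + 1))}"
proof -
  have four_dvd: "4 dvd (2 ^ k :: nat) \<longleftrightarrow> (\<exists>n>0. k = n + 1)" for k
  proof -
    have "4 dvd (2 ^ k :: nat) \<longleftrightarrow> 2 ^ 2 dvd (2 ^ k :: nat)"
      by simp
    also have "\<dots> \<longleftrightarrow> 2 \<le> k"
      by (rule dvd_power_iff_le) simp
    also have "\<dots> \<longleftrightarrow> (\<exists>n>0. k = n + 1)"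
      by presburger
    finally show ?thesis .
  qed
  have "(0 < N \<and> sum_successive_odd N \<and> \<not> sum_successive_even N) \<longleftrightarrow>
        (0 < N \<and> odd N \<and> composite N) \<or> (even N \<and> (\<exists>n>0. N = 2 ^ (n + 1)))" for N :: nat
  proof (cases "N = 0")
    case False
    have "4 dvd N \<Longrightarrow> even N"
      by (rule dvd_trans[of 2 4]) simp_all
    with False have "(0 < N \<and> sum_successive_odd N \<and> \<not> sum_successive_even N) \<longleftrightarrow>
        (odd N \<and> composite N) \<or> (even N \<and> (\<exists>k. 4 dvd N \<and> N = 2 ^ k))"
      using sum_successive_odd_iff[of N] sum_successive_even_iff[of N] by auto
    also have "(\<exists>k. 4 dvd N \<and> N = 2 ^ k) \<longleftrightarrow> (\<exists>k. 4 dvd (2 ^ k :: nat) \<and> N = 2 ^ k)"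
      by blast
    also have "\<dots> \<longleftrightarrow> (\<exists>n>0. N = 2 ^ (n + 1))"
      unfolding four_dvd by blast
    finally show ?thesis
      using False by simp
  qed simp
  then show ?thesis
    by blast
qed

end
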